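(* Let $i\in\mathbb{Z}$, let $M_-,M_+\in\mathbb{Z}$ with $M:=M_-+M_+\geq2$, and let $\mathrm{X}_{i-M_-,i+M_+}=\{x_{i-M_-},\dots,x_{i+M_+}\}$ be a stencil of real points $x_{i-M_-}<\cdots<x_{i+M_+}$. For $K_{\mathrm{s}}\in\{1,\dots,M-1\}$, $n\in\{0,\dots,M-K_{\mathrm{s}}\}$ and $k_{\mathrm{s}}\in\{0,\dots,K_{\mathrm{s}}\}$, define rational functions recursively (for this stencil and likewise for its substencils of consecutive points) by $$\sigma^{[n]}_{\mathrm{X}_{i-M_-,i+M_+},K_{\mathrm{s}},k_{\mathrm{s}}}(x):=\begin{cases}\dfrac{\alpha^{(n)}_{\mathrm{X}_{i-M_-,i+M_+},\,i-M_-+k_{\mathrm{s}}M}(x)}{\alpha^{(n)}_{\mathrm{X}_{i-M_-+k_{\mathrm{s}},\,i+M_+-1+k_{\mathrm{s}}},\,i-M_-+k_{\mathrm{s}}M}(x)} & K_{\mathrm{s}}=1,\\[4mm] \displaystyle\sum_{\ell_{\mathrm{s}}=\max(0,k_{\mathrm{s}}-1)}^{\min(K_{\mathrm{s}}-1,k_{\mathrm{s}})}\sigma^{[n]}_{\mathrm{X}_{i-M_-,i+M_+},K_{\mathrm{s}}-1,\ell_{\mathrm{s}}}(x)\;\sigma^{[n]}_{\mathrm{X}_{i-M_-+\ell_{\mathrm{s}},\,i+M_+-(K_{\mathrm{s}}-1)+\ell_{\mathrm{s}}},1,k_{\mathrm{s}}-\ell_{\mathrm{s}}}(x) & K_{\mathrm{s}}\geq2,\end{cases}$$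 and let $\mathcal{S}^{[n]}_{\mathrm{X}_{i-M_-,i+M_+},K_{\mathrm{s}}}\subset\mathbb{R}$ be the set of real poles of the rational functions $\sigma^{[n]}_{\mathrm{X}_{i-M_-,i+M_+},K_{\mathrm{s}},k_{\mathrm{s}}}$, $k_{\mathrm{s}}\in\{0,\dots,K_{\mathrm{s}}\}$. Then, for all $K_{\mathrm{s}}\in\{1,\dots,M-1\}$ and all $n\in\{0,\dots,M-K_{\mathrm{s}}\}$: 1. For every $f:\mathbb{R}\to\mathbb{R}$ and every $x\in\mathbb{R}\setminus\mathcal{S}^{[n]}_{\mathrm{X}_{i-M_-,i+M_+},K_{\mathrm{s}}}$, $$p^{(n)}_{\mathrm{X}_{i-M_-,i+M_+}}(x;f)=\sum_{k_{\mathrm{s}}=0}^{K_{\mathrm{s}}}\sigma^{[n]}_{\mathrm{X}_{i-M_-,i+M_+},K_{\mathrm{s}},k_{\mathrm{s}}}(x)\;p^{(n)}_{\mathrm{X}_{i-M_-+k_{\mathrm{s}},\,i+M_+-K_{\mathrm{s}}+k_{\mathrm{s}}}}(x;f).$$ 2. For every $x\in\mathbb{R}\setminus\mathcal{S}^{[n]}_{\mathrm{X}_{i-M_-,i+M_+},K_{\mathrm{s}}}$, $\displaystyle\sum_{k_{\mathrm{s}}=0}^{K_{\mathrm{s}}}\sigma^{[n]}_{\mathrm{X}_{i-M_-,i+M_+},K_{\mathrm{s}},k_{\mathrm{s}}}(x)=1$. 3. The sets of poles satisfy $$\mathcal{S}^{[n]}_{\mathrm{X}_{i-M_-,i+M_+},1}\subseteq\left\{x\in\mathbb{R}:\alpha^{(n)}_{\mathrm{X}_{i-M_-+1,i+M_+},\,i+M_+}(x)=0\right\},$$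 $$\mathcal{S}^{[n]}_{\mathrm{X}_{i-M_-,i+M_+},K_{\mathrm{s}}}\subseteq\bigcup_{L_{\mathrm{s}}=0}^{K_{\mathrm{s}}-1}\bigcup_{\ell_{\mathrm{s}}=0}^{L_{\mathrm{s}}}\mathcal{S}^{[n]}_{\mathrm{X}_{i-M_-+\ell_{\mathrm{s}},\,i+M_+-L_{\mathrm{s}}+\ell_{\mathrm{s}}},1}\subseteq\left\{x\in\mathbb{R}:\prod_{L_{\mathrm{s}}=0}^{K_{\mathrm{s}}-1}\prod_{\ell_{\mathrm{s}}=0}^{L_{\mathrm{s}}}\alpha^{(n)}_{\mathrm{X}_{i-M_-+1+\ell_{\mathrm{s}},\,i+M_+-L_{\mathrm{s}}+\ell_{\mathrm{s}}},\,i+M_+-L_{\mathrm{s}}+\ell_{\mathrm{s}}}(x)=0\right\}.$$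
   Context: For integers $a\leq b$ and real points $x_a<\cdots<x_b$, write $\mathrm{X}_{a,b}:=\{x_a,\dots,x_b\}$ (a stencil). The fundamental polynomials of Lagrange interpolation on $\mathrm{X}_{a,b}$ are $$\alpha_{\mathrm{X}_{a,b},j}(x):=\prod_{\substack{k=a\\k\neq j}}^{b}\frac{x-x_k}{x_j-x_k},\qquad j\in\{a,\dots,b\},$$ and the Lagrange interpolating polynomial of $f:\mathbb{R}\to\mathbb{R}$ on $\mathrm{X}_{a,b}$ is $p_{\mathrm{X}_{a,b}}(x;f)=\sum_{j=a}^{b}\alpha_{\mathrm{X}_{a,b},j}(x)f(x_j)$. The superscript $(n)$ denotes the $n$-th derivative with respect to $x$ ($n=0$ meaning no differentiation). Rational functions are understood after cancellation of common factors, so a real number is a pole only if it is a genuine (non-removable) singularity, and values at removable singularities are those of the reduced rational function. In the level-1 definition, $i-M_-+k_{\mathrm{s}}M$ equals $i-M_-$ for $k_{\mathrm{s}}=0$ and $i+M_+$ for $k_{\mathrm{s}}=1$. For a general stencil $\mathrm{X}_{a,b}$ the definition is applied with $i-M_-$, $i+M_+$, $M$ replaced by $a$, $b$, $b-a$. *)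

theory Defs
  imports "HOL-Analysis.Analysis" "HOL-Computational_Algebra.Computational_Algebra"
    "HOL-Computational_Algebra.Field_as_Ring"
begin

text \<open>
  A stencil of points indexed by \<^term>\<open>{a..b}\<close> is given by a map \<open>x\<close> from the integers to the
  reals together with the end indices \<open>a\<close>, \<open>b\<close>; values of \<open>x\<close> outside \<^term>\<open>{a..b}\<close> are never used.
\<close>

definition fund_poly :: "(int \<Rightarrow> real) \<Rightarrow> int \<Rightarrow> int \<Rightarrow> int \<Rightarrow> real poly" where
  "fund_poly x a b j = (\<Prod>k\<in>{a..b} - {j}. smult (1 / (x j - x k)) [:- x k, 1:])"

definition lagrange_poly :: "(int \<Rightarrow> real) \<Rightarrow> int \<Rightarrow> int \<Rightarrow> (real \<Rightarrow> real) \<Rightarrow> real poly" where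
  "lagrange_poly x a b f = (\<Sum>j\<in>{a..b}. smult (f (x j)) (fund_poly x a b j))"

lemma poly_fund_poly:
  "poly (fund_poly x a b j) t = (\<Prod>k\<in>{a..b} - {j}. (t - x k) / (x j - x k))"
  by (simp add: fund_poly_def poly_prod diff_divide_distrib)

lemma poly_lagrange_poly:
  "poly (lagrange_poly x a b f) t = (\<Sum>j\<in>{a..b}. poly (fund_poly x a b j) t * f (x j))"
  by (simp add: lagrange_poly_def poly_sum mult.commute)

lemma higher_deriv_poly:
  fixes p :: "real poly"
  shows "(deriv ^^ n) (poly p) = poly ((pderiv ^^ n) p)"
proof (induction n)
  case (Suc n)
  have "deriv (poly q) = poly (pderiv q)" for q :: "real poly"
    by (rule ext) (rule DERIV_imp_deriv[OF poly_DERIV])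
  then show ?case using Suc by simp
qed simp

text \<open>
  Rational functions are elements of the fraction field of the real polynomials.
  The library function \<^const>\<open>quot_of_fract\<close> returns the coprime numerator and denominator, so
  evaluation and poles refer to the reduced rational function.
\<close>

definition ratfun_eval :: "real poly fract \<Rightarrow> real \<Rightarrow> real" where
  "ratfun_eval r t = poly (fst (quot_of_fract r)) t / poly (snd (quot_of_fract r)) t"

definition ratfun_pole :: "real poly fract \<Rightarrow> real \<Rightarrow> bool" where
  "ratfun_pole r t \<longleftrightarrow> poly (snd (quot_of_fract r)) t = 0"

definition sigma_weight_1 :: "(int \<Rightarrow> real) \<Rightarrow> nat \<Rightarrow> int \<Rightarrow> int \<Rightarrow> nat \<Rightarrow> real poly fract" where
  "sigma_weight_1 x n a b k =
     Fract ((pderiv ^^ n) (fund_poly x a b (a + int k * (b - a))))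
           ((pderiv ^^ n) (fund_poly x (a + int k) (b - 1 + int k) (a + int k * (b - a))))"

text \<open>
  The weight function of level \<open>K\<close> with index \<open>k\<close> on the stencil indexed by \<^term>\<open>{a..b}\<close>;
  it is meaningful for \<open>1 \<le> K < b - a\<close>, \<open>n \<le> b - a - K\<close> and \<open>k \<le> K\<close>, and level 0 is a dummy.
  In the recursive equation the lower summation bound \<open>k - 1\<close> is truncated subtraction,
  i.e. \<open>max 0 (k - 1)\<close>.
\<close>

fun sigma_weight :: "(int \<Rightarrow> real) \<Rightarrow> nat \<Rightarrow> int \<Rightarrow> int \<Rightarrow> nat \<Rightarrow> nat \<Rightarrow> real poly fract" where
  "sigma_weight x n a b 0 k = 0"
| "sigma_weight x n a b (Suc 0) k = sigma_weight_1 x n a b k"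
| "sigma_weight x n a b (Suc (Suc K)) k =
     (\<Sum>l = k - 1..min (Suc K) k.
        sigma_weight x n a b (Suc K) l * sigma_weight_1 x n (a + int l) (b - int (Suc K) + int l) (k - l))"

definition pole_set :: "(int \<Rightarrow> real) \<Rightarrow> nat \<Rightarrow> int \<Rightarrow> int \<Rightarrow> nat \<Rightarrow> real set" where
  "pole_set x n a b K = {t. \<exists>k\<in>{0..K}. ratfun_pole (sigma_weight x n a b K k) t}"

end

theory Submission
  imports Defs
begin

text \<open>
  Let \<open>w\<close> be the monic polynomial vanishing at the points strictly between \<open>x a\<close> and \<open>x b\<close>, let
  \<open>A = X - x a\<close>, \<open>B = X - x b\<close> and let \<open>T\<close> be the \<open>n\<close>-th derivative. The level-one weights are
  \<open>T (w B) / ((x a - x b) T w)\<close> and \<open>T (w A) / ((x b - x a) T w)\<close>. By Newton's form, the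
  interpolants on the two substencils arise from the one on the full stencil by subtracting
  \<open>D w A\<close> and \<open>D w B\<close> with the same divided difference \<open>D\<close>. Hence the products with \<open>D\<close> cancel
  in the level-one identity, which reduces to \<open>T (w B) - T (w A) = (x a - x b) T w\<close>. Only the
  linearity of \<open>T\<close> and \<open>T w \<noteq> 0\<close> are used. Higher levels follow by induction in the field of
  rational functions, and evaluation is a homomorphism away from the poles.
\<close>

section \<open>Evaluation of rational functions\<close>

text \<open>If \<open>u / v\<close> is the reduced form, then \<open>u * q = p * v\<close>. At a
  pole \<open>v\<close> vanishes, and by coprimality \<open>u\<close> does not, so \<open>q\<close>
  must vanish.\<close>

lemma ratfun_pole_imp_denominator_zero:
  assumes "ratfun_pole (Fract p q) t"
  shows "poly q t = 0"
proof (cases "q = 0")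
  case False
  define u v where "u = fst (quot_of_fract (Fract p q))" and "v = snd (quot_of_fract (Fract p q))"
  have "Fract u v = Fract p q" and "v \<noteq> 0"
    by (simp_all add: u_def v_def)
  then have eq: "u * q = p * v"
    using False by (simp add: eq_fract)
  have "coprime u v"
    by (simp add: u_def v_def coprime_quot_of_fract)
  have v: "poly v t = 0"
    using assms by (simp add: ratfun_pole_def v_def)
  have "poly u t \<noteq> 0"
  proof
    assume "poly u t = 0"
    with v have "[:-t, 1:] dvd u" "[:-t, 1:] dvd v"
      by (simp_all add: poly_eq_0_iff_dvd)
    with \<open>coprime u v\<close> have "is_unit [:-t, 1:]"
      by (rule coprime_common_divisor)
    then show False
      by (simp add: is_unit_iff_degree)
  qed
  moreover have "poly u t * poly q t = 0"
    using arg_cong[OF eq, of "\<lambda>r. poly r t"] v by simp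
  ultimately show ?thesis by simp
qed simp

text \<open>Evaluation may use any representative regular at \<open>t\<close>: cross-multiplication
  compares it with the reduced one, whose denominator is nonzero at \<open>t\<close> by the previous
  lemma.\<close>

lemma ratfun_eval_Fract:
  assumes "poly q t \<noteq> 0"
  shows "ratfun_eval (Fract p q) t = poly p t / poly q t"
proof -
  define u v where "u = fst (quot_of_fract (Fract p q))" and "v = snd (quot_of_fract (Fract p q))"
  have "Fract u v = Fract p q" and "v \<noteq> 0"
    by (simp_all add: u_def v_def)
  moreover have "q \<noteq> 0" using assms by auto
  ultimately have "u * q = p * v"
    by (simp add: eq_fract)
  from arg_cong[OF this, of "\<lambda>r. poly r t"] have "poly u t * poly q t = poly p t * poly v t"
    by simp
  moreover have "poly v t \<noteq> 0"
    using assms ratfun_pole_imp_denominator_zero[of p q t] by (auto simp: ratfun_pole_def v_def)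
  ultimately show ?thesis
    using assms by (simp add: ratfun_eval_def u_def v_def field_simps)
qed

lemma not_ratfun_poleE:
  assumes "\<not> ratfun_pole r t"
  obtains p q where "r = Fract p q" "poly q t \<noteq> 0"
  using assms that[of "fst (quot_of_fract r)" "snd (quot_of_fract r)"]
  by (simp add: ratfun_pole_def)

lemma ratfun_to_fract [simp]:
  "\<not> ratfun_pole (to_fract p) t" "ratfun_eval (to_fract p) t = poly p t"
  by (simp_all add: ratfun_pole_def ratfun_eval_def)

text \<open>The functions regular at \<open>t\<close> form a ring on which evaluation is a
  homomorphism: the denominators \<open>q\<close> and \<open>v\<close> do not vanish at
  \<open>t\<close>, hence neither does the common denominator \<open>q * v\<close>.\<close>

lemma
  assumes "\<not> ratfun_pole r t" "\<not> ratfun_pole s t"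
  shows ratfun_pole_add: "\<not> ratfun_pole (r + s) t"
    and ratfun_eval_add: "ratfun_eval (r + s) t = ratfun_eval r t + ratfun_eval s t"
    and ratfun_pole_mult: "\<not> ratfun_pole (r * s) t"
    and ratfun_eval_mult: "ratfun_eval (r * s) t = ratfun_eval r t * ratfun_eval s t"
proof -
  obtain p q where r: "r = Fract p q" "poly q t \<noteq> 0"
    using assms(1) by (rule not_ratfun_poleE)
  obtain u v where s: "s = Fract u v" "poly v t \<noteq> 0"
    using assms(2) by (rule not_ratfun_poleE)
  have nz: "q \<noteq> 0" "v \<noteq> 0" "poly (q * v) t \<noteq> 0"
    using r s by auto
  have sum: "r + s = Fract (p * v + u * q) (q * v)"
    unfolding r(1) s(1) using nz by (intro add_fract)
  have prod: "r * s = Fract (p * u) (q * v)"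
    unfolding r(1) s(1) by (rule mult_fract)
  show "\<not> ratfun_pole (r + s) t" "\<not> ratfun_pole (r * s) t"
    unfolding sum prod using nz(3) ratfun_pole_imp_denominator_zero by blast+
  have eval: "ratfun_eval r t = poly p t / poly q t" "ratfun_eval s t = poly u t / poly v t"
    unfolding r(1) s(1) using r(2) s(2) by (simp_all only: ratfun_eval_Fract not_False_eq_True)
  show "ratfun_eval (r + s) t = ratfun_eval r t + ratfun_eval s t"
    unfolding sum eval ratfun_eval_Fract[OF nz(3)] using r(2) s(2) by (simp add: add_frac_eq)
  show "ratfun_eval (r * s) t = ratfun_eval r t * ratfun_eval s t"
    unfolding prod eval ratfun_eval_Fract[OF nz(3)] by simp
qed

lemma ratfun_sum:
  assumes "\<And>i. i \<in> I \<Longrightarrow> \<not> ratfun_pole (r i) t"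
  shows "\<not> ratfun_pole (sum r I) t \<and> ratfun_eval (sum r I) t = (\<Sum>i\<in>I. ratfun_eval (r i) t)"
  using assms
proof (induction I rule: infinite_finite_induct)
  case (insert i I)
  then show ?case by (simp add: ratfun_pole_add ratfun_eval_add)
\<comment> \<open>Over an empty or infinite index set the sum is 0, that is
  \<open>to_fract 0\<close>.\<close>
qed (use ratfun_to_fract[of 0 t] in simp_all)

text \<open>Turns scalars into elements of the fraction field, so that later identities become field
  arithmetic.\<close>

lemma to_fract_smult: "to_fract (smult c p) = to_fract [:c:] * to_fract p"
  by (simp flip: to_fract_mult)

section \<open>Newton's form of the interpolating polynomial\<close>

text \<open>Index sets replace integer intervals here and below, so that dropping either end of a
  stencil is the same operation \<open>S - {s}\<close>.\<close>

definition nodal_poly :: "('i \<Rightarrow> real) \<Rightarrow> 'i set \<Rightarrow> real poly" where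
  "nodal_poly x S = (\<Prod>k\<in>S. [:- x k, 1:])"

text \<open>Newton's divided difference in its symmetric form.\<close>

definition divided_difference :: "('i \<Rightarrow> real) \<Rightarrow> 'i set \<Rightarrow> (real \<Rightarrow> real) \<Rightarrow> real" where
  "divided_difference x S f = (\<Sum>j\<in>S. f (x j) * (\<Prod>k\<in>S - {j}. 1 / (x j - x k)))"

definition lagrange_basis :: "('i \<Rightarrow> real) \<Rightarrow> 'i set \<Rightarrow> 'i \<Rightarrow> real poly" where
  "lagrange_basis x S j = smult (\<Prod>k\<in>S - {j}. 1 / (x j - x k)) (nodal_poly x (S - {j}))"

lemma prod_smult: "(\<Prod>k\<in>S. smult (c k) (p k)) = smult (\<Prod>k\<in>S. c k) (\<Prod>k\<in>S. p k)"
  by (induction S rule: infinite_finite_induct) (simp_all add: mult.commute)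

lemma fund_poly_eq_lagrange_basis: "fund_poly x a b j = lagrange_basis x {a..b} j"
  unfolding fund_poly_def lagrange_basis_def nodal_poly_def by (rule prod_smult)

lemma nodal_poly_remove:
  "finite S \<Longrightarrow> s \<in> S \<Longrightarrow> nodal_poly x S = [:- x s, 1:] * nodal_poly x (S - {s})"
  unfolding nodal_poly_def by (rule prod.remove)

lemma degree_nodal_poly: "finite S \<Longrightarrow> degree (nodal_poly x S) = card S"
  unfolding nodal_poly_def by (subst degree_prod_eq_sum_degree) auto

text \<open>With \<open>d\<close>, \<open>e\<close>, \<open>N\<close> as in the proof,
  \<open>e = d * (x j - x s)\<close>. After dividing by \<open>d\<close> and \<open>N\<close> the
  claim is \<open>X - x s = (x j - x s) + (X - x j)\<close>.\<close>

lemma lagrange_basis_remove: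
  assumes "finite S" "inj_on x S" "s \<in> S" "j \<in> S" "j \<noteq> s"
  shows "lagrange_basis x S j = lagrange_basis x (S - {s}) j
           + smult (\<Prod>k\<in>S - {j}. 1 / (x j - x k)) (nodal_poly x (S - {s}))"
proof -
  have comm: "S - {s} - {j} = S - {j} - {s}" by auto
  define N d e where "N = nodal_poly x (S - {j} - {s})"
    and "d = (\<Prod>k\<in>S - {j}. 1 / (x j - x k))" and "e = (\<Prod>k\<in>S - {j} - {s}. 1 / (x j - x k))"
  have ne: "x j \<noteq> x s"
    using assms by (auto dest: inj_onD)
  have "d = 1 / (x j - x s) * e"
    unfolding d_def e_def using assms by (intro prod.remove) auto
  then have e: "e = d * (x j - x s)"
    using ne by simp
  have 1: "nodal_poly x (S - {j}) = [:- x s, 1:] * N"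
    unfolding N_def using assms by (intro nodal_poly_remove) auto
  have 2: "nodal_poly x (S - {s}) = [:- x j, 1:] * N"
    unfolding N_def comm[symmetric] using assms by (intro nodal_poly_remove) auto
  have 3: "nodal_poly x (S - {s} - {j}) = N"
    by (simp add: N_def comm)
  show ?thesis
    unfolding lagrange_basis_def 3 1 2 d_def[symmetric] comm e_def[symmetric] e
    unfolding N_def[symmetric]
    by (rule poly_eqI) (simp add: algebra_simps)
qed

text \<open>One step of Newton's form. The previous lemma is summed over \<open>j\<close> other than
  \<open>s\<close>; the basis polynomial of \<open>s\<close> is itself a multiple of the nodal
  polynomial of \<open>S - {s}\<close>, and the coefficients add up to the divided
  difference.\<close>

lemma lagrange_sum_remove:
  assumes "finite S" "inj_on x S" "s \<in> S"
  shows "(\<Sum>j\<in>S. smult (f (x j)) (lagrange_basis x S j)) =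
         (\<Sum>j\<in>S - {s}. smult (f (x j)) (lagrange_basis x (S - {s}) j))
           + smult (divided_difference x S f) (nodal_poly x (S - {s}))"
proof -
  let ?d = "\<lambda>j. \<Prod>k\<in>S - {j}. 1 / (x j - x k)" and ?N = "nodal_poly x (S - {s})"
  have "(\<Sum>j\<in>S. smult (f (x j)) (lagrange_basis x S j)) =
        smult (f (x s)) (lagrange_basis x S s) + (\<Sum>j\<in>S - {s}. smult (f (x j)) (lagrange_basis x S j))"
    using assms by (intro sum.remove)
  also have "(\<Sum>j\<in>S - {s}. smult (f (x j)) (lagrange_basis x S j)) =
      (\<Sum>j\<in>S - {s}. smult (f (x j)) (lagrange_basis x (S - {s}) j) + smult (f (x j) * ?d j) ?N)"
    using assms by (intro sum.cong) (auto simp: lagrange_basis_remove[of S x s] smult_add_right)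
  also have "\<dots> = (\<Sum>j\<in>S - {s}. smult (f (x j)) (lagrange_basis x (S - {s}) j))
      + smult (\<Sum>j\<in>S - {s}. f (x j) * ?d j) ?N"
    by (simp add: sum.distrib smult_sum)
  also have "smult (f (x s)) (lagrange_basis x S s) = smult (f (x s) * ?d s) ?N"
    by (simp add: lagrange_basis_def)
  also have "divided_difference x S f = f (x s) * ?d s + (\<Sum>j\<in>S - {s}. f (x j) * ?d j)"
    unfolding divided_difference_def using assms by (intro sum.remove)
  ultimately show ?thesis
    by (simp add: smult_add_left algebra_simps)
qed

text \<open>Dropping \<open>b\<close> leaves a nodal polynomial with the extra factor
  \<open>X - x a\<close>, dropping \<open>a\<close> one with \<open>X - x b\<close>. The coefficient
  depends on the full stencil only and is therefore the same in both.\<close>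

lemma
  fixes x :: "int \<Rightarrow> real"
  assumes "a < b" "inj_on x {a..b}"
  shows lagrange_poly_remove_right: "lagrange_poly x a b f = lagrange_poly x a (b - 1) f
          + smult (divided_difference x {a..b} f) ([:- x a, 1:] * nodal_poly x {a<..<b})"
    and lagrange_poly_remove_left: "lagrange_poly x a b f = lagrange_poly x (a + 1) b f
          + smult (divided_difference x {a..b} f) ([:- x b, 1:] * nodal_poly x {a<..<b})"
proof -
  have sets: "{a..b} - {b} = {a..b - 1}" "{a..b} - {a} = {a + 1..b}"
    "{a..b - 1} - {a} = {a<..<b}" "{a + 1..b} - {b} = {a<..<b}"
    using assms(1) by auto
  have "nodal_poly x {a..b - 1} = [:- x a, 1:] * nodal_poly x {a<..<b}"
    using nodal_poly_remove[of "{a..b - 1}" a x] assms(1) by (simp add: sets)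
  with lagrange_sum_remove[of "{a..b}" x b f] assms
  show "lagrange_poly x a b f = lagrange_poly x a (b - 1) f
      + smult (divided_difference x {a..b} f) ([:- x a, 1:] * nodal_poly x {a<..<b})"
    by (simp add: lagrange_poly_def fund_poly_eq_lagrange_basis sets)
  have "nodal_poly x {a + 1..b} = [:- x b, 1:] * nodal_poly x {a<..<b}"
    using nodal_poly_remove[of "{a + 1..b}" b x] assms(1) by (simp add: sets)
  with lagrange_sum_remove[of "{a..b}" x a f] assms
  show "lagrange_poly x a b f = lagrange_poly x (a + 1) b f
      + smult (divided_difference x {a..b} f) ([:- x b, 1:] * nodal_poly x {a<..<b})"
    by (simp add: lagrange_poly_def fund_poly_eq_lagrange_basis sets)
qed

section \<open>Weights of level one\<close>

text \<open>The coefficient at \<open>degree p - n\<close> is the leading coefficient of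
  \<open>p\<close> times a nonzero Pochhammer symbol.\<close>

lemma higher_pderiv_neq_0:
  fixes p :: "real poly"
  assumes "p \<noteq> 0" "n \<le> degree p"
  shows "(pderiv ^^ n) p \<noteq> 0"
proof -
  have "coeff ((pderiv ^^ n) p) (degree p - n) \<noteq> 0"
    using assms by (simp add: coeff_higher_pderiv pochhammer_eq_0_iff)
  then show ?thesis by auto
qed

lemma higher_pderiv_nodal_poly_neq_0:
  fixes a b :: int
  assumes "int n \<le> b - a - 1"
  shows "(pderiv ^^ n) (nodal_poly x {a<..<b}) \<noteq> 0"
proof (rule higher_pderiv_neq_0)
  show "nodal_poly x {a<..<b} \<noteq> 0"
    by (simp add: nodal_poly_def)
  show "n \<le> degree (nodal_poly x {a<..<b})"
    using assms by (simp add: degree_nodal_poly)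
qed

text \<open>Removes the normalising constant shared by the fundamental polynomials of an end node on
  the full stencil and on the substencil.\<close>

lemma Fract_smult_cancel:
  fixes p q :: "real poly"
  assumes "c \<noteq> 0"
  shows "Fract (smult (d * c) p) (smult c q) = Fract (smult d p) q"
proof -
  have "smult (d * c) p = [:c:] * smult d p" "smult c q = [:c:] * q"
    by (simp_all add: mult.commute)
  then show ?thesis using assms by (simp only:) (rule mult_fract_cancel, simp)
qed

lemma
  fixes x :: "int \<Rightarrow> real"
  assumes "a < b" "inj_on x {a..b}"
  shows sigma_weight_1_0: "sigma_weight_1 x n a b 0 =
          Fract (smult (1 / (x a - x b)) ((pderiv ^^ n) ([:- x b, 1:] * nodal_poly x {a<..<b})))
            ((pderiv ^^ n) (nodal_poly x {a<..<b}))"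
    and sigma_weight_1_1: "sigma_weight_1 x n a b (Suc 0) =
          Fract (smult (1 / (x b - x a)) ((pderiv ^^ n) ([:- x a, 1:] * nodal_poly x {a<..<b})))
            ((pderiv ^^ n) (nodal_poly x {a<..<b}))"
proof -
  have sets: "{a..b} - {b} = {a..b - 1}" "{a..b} - {a} = {a + 1..b}"
    "{a..b - 1} - {a} = {a<..<b}" "{a + 1..b} - {b} = {a<..<b}"
    using assms(1) by auto
  \<comment> \<open>These normalise the fundamental polynomial of \<open>x a\<close> on
    \<open>{a..b - 1}\<close> and that of \<open>x b\<close> on \<open>{a + 1..b}\<close>. On
    \<open>{a..b}\<close> each gains only the factor for the opposite end.\<close>
  define c d where "c = (\<Prod>k\<in>{a<..<b}. 1 / (x a - x k))" and "d = (\<Prod>k\<in>{a<..<b}. 1 / (x b - x k))"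
  have "c \<noteq> 0" "d \<noteq> 0"
    using assms by (auto simp: c_def d_def dest: inj_onD)
  have "nodal_poly x {a + 1..b} = [:- x b, 1:] * nodal_poly x {a<..<b}"
    "(\<Prod>k\<in>{a + 1..b}. 1 / (x a - x k)) = 1 / (x a - x b) * c"
    using nodal_poly_remove[of "{a + 1..b}" b x] assms(1)
      prod.remove[of "{a + 1..b}" b "\<lambda>k. 1 / (x a - x k)"] by (simp_all add: sets c_def)
  then have "fund_poly x a b a = smult (1 / (x a - x b) * c) ([:- x b, 1:] * nodal_poly x {a<..<b})"
    "fund_poly x a (b - 1) a = smult c (nodal_poly x {a<..<b})"
    by (simp_all only: fund_poly_eq_lagrange_basis lagrange_basis_def sets c_def)
  then show "sigma_weight_1 x n a b 0 =
          Fract (smult (1 / (x a - x b)) ((pderiv ^^ n) ([:- x b, 1:] * nodal_poly x {a<..<b})))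
            ((pderiv ^^ n) (nodal_poly x {a<..<b}))"
    using Fract_smult_cancel[OF \<open>c \<noteq> 0\<close>, of "1 / (x a - x b)"] assms(1)
    by (simp add: sigma_weight_1_def higher_pderiv_smult del: mult_pCons_left)
  have "nodal_poly x {a..b - 1} = [:- x a, 1:] * nodal_poly x {a<..<b}"
    "(\<Prod>k\<in>{a..b - 1}. 1 / (x b - x k)) = 1 / (x b - x a) * d"
    using nodal_poly_remove[of "{a..b - 1}" a x] assms(1)
      prod.remove[of "{a..b - 1}" a "\<lambda>k. 1 / (x b - x k)"] by (simp_all add: sets d_def)
  then have "fund_poly x a b b = smult (1 / (x b - x a) * d) ([:- x a, 1:] * nodal_poly x {a<..<b})"
    "fund_poly x (a + 1) b b = smult d (nodal_poly x {a<..<b})"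
    by (simp_all only: fund_poly_eq_lagrange_basis lagrange_basis_def sets d_def)
  then show "sigma_weight_1 x n a b (Suc 0) =
          Fract (smult (1 / (x b - x a)) ((pderiv ^^ n) ([:- x a, 1:] * nodal_poly x {a<..<b})))
            ((pderiv ^^ n) (nodal_poly x {a<..<b}))"
    using Fract_smult_cancel[OF \<open>d \<noteq> 0\<close>, of "1 / (x b - x a)"] assms(1)
    by (simp add: sigma_weight_1_def higher_pderiv_smult del: mult_pCons_left)
qed

lemma
  fixes x :: "int \<Rightarrow> real"
  assumes "inj_on x {a..b}" "int n \<le> b - a - 1"
  shows sigma_weight_1_sum: "sigma_weight_1 x n a b 0 + sigma_weight_1 x n a b (Suc 0) = 1"
    and sigma_weight_1_lagrange: "to_fract ((pderiv ^^ n) (lagrange_poly x a b f)) =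
          sigma_weight_1 x n a b 0 * to_fract ((pderiv ^^ n) (lagrange_poly x a (b - 1) f))
          + sigma_weight_1 x n a b (Suc 0) * to_fract ((pderiv ^^ n) (lagrange_poly x (a + 1) b f))"
proof -
  have "a < b" using assms(2) by simp
  define w where "w = nodal_poly x {a<..<b}"
  define c where "c = x a - x b"
  define D where "D = divided_difference x {a..b} f"
  have "c \<noteq> 0"
    using assms(1) \<open>a < b\<close> by (auto simp: c_def dest: inj_onD)
  let ?T = "\<lambda>p. to_fract ((pderiv ^^ n) p)"
  let ?A = "?T ([:- x a, 1:] * w)" and ?B = "?T ([:- x b, 1:] * w)"
  define C E where "C = to_fract [:c:]" and "E = to_fract [:D:]"
  \<comment> \<open>The two linear factors differ by the constant \<open>c = x a - x b\<close>;
    applying the derivative gives \<open>?B - ?A = C * ?T w\<close>, which makes the weights sum to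
    1.\<close>
  have "[:- x b, 1:] * w = [:- x a, 1:] * w + smult c w"
    by (rule poly_eqI) (simp add: c_def algebra_simps)
  then have B: "?B = ?A + C * ?T w"
    by (simp only: higher_pderiv_add higher_pderiv_smult to_fract_add to_fract_smult C_def)
  have W: "?T w \<noteq> 0"
    using higher_pderiv_nodal_poly_neq_0[OF assms(2)] by (simp add: w_def)
  have C: "C \<noteq> 0" using \<open>c \<noteq> 0\<close> by (simp add: C_def)
  have "to_fract [:1 / c:] * C = 1"
    using \<open>c \<noteq> 0\<close> by (simp add: C_def one_pCons flip: to_fract_mult to_fract_1)
  then have inv: "to_fract [:1 / c:] = 1 / C"
    using C by (simp add: eq_divide_eq)
  have "1 / (x b - x a) = - (1 / c)"
    using \<open>c \<noteq> 0\<close> by (simp add: c_def field_simps)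
  then have "[:1 / (x b - x a):] = - [:1 / c:]"
    by simp
  then have inv': "to_fract [:1 / (x b - x a):] = - (1 / C)"
    using inv by (simp only: to_fract_uminus)
  have s0: "sigma_weight_1 x n a b 0 = ?B / (C * ?T w)"
    using sigma_weight_1_0[OF \<open>a < b\<close> assms(1), of n, folded w_def c_def] inv
    by (simp only: Fract_conv_to_fract to_fract_smult) simp
  have s1: "sigma_weight_1 x n a b (Suc 0) = - ?A / (C * ?T w)"
    using sigma_weight_1_1[OF \<open>a < b\<close> assms(1), of n, folded w_def] inv'
    by (simp only: Fract_conv_to_fract to_fract_smult) simp
  show "sigma_weight_1 x n a b 0 + sigma_weight_1 x n a b (Suc 0) = 1"
    unfolding s0 s1 B using W C by (simp add: field_simps)
  have L: "?T (lagrange_poly x a b f) = ?T (lagrange_poly x a (b - 1) f) + E * ?A"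
    unfolding lagrange_poly_remove_right[OF \<open>a < b\<close> assms(1)] w_def E_def D_def
    by (simp only: higher_pderiv_add higher_pderiv_smult to_fract_add to_fract_smult)
  have R: "?T (lagrange_poly x a b f) = ?T (lagrange_poly x (a + 1) b f) + E * ?B"
    unfolding lagrange_poly_remove_left[OF \<open>a < b\<close> assms(1)] w_def E_def D_def
    by (simp only: higher_pderiv_add higher_pderiv_smult to_fract_add to_fract_smult)
  \<comment> \<open>Both substencil interpolants are written through \<open>l\<close>. The weighted
    sum is \<open>l\<close> times the sum of the weights, while the \<open>E\<close> terms
    contribute \<open>?B * ?A - ?A * ?B = 0\<close>.\<close>
  define l where "l = ?T (lagrange_poly x a b f)"
  have L': "?T (lagrange_poly x a (b - 1) f) = l - E * ?A"
    and R': "?T (lagrange_poly x (a + 1) b f) = l - E * ?B"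
    using L R by (simp_all add: l_def)
  show "?T (lagrange_poly x a b f) = sigma_weight_1 x n a b 0 * ?T (lagrange_poly x a (b - 1) f)
          + sigma_weight_1 x n a b (Suc 0) * ?T (lagrange_poly x (a + 1) b f)"
    unfolding s0 s1 L' R' l_def[symmetric] B using W C by (simp add: field_simps)
qed

section \<open>Weights of higher levels\<close>

text \<open>For \<open>k\<close> up to \<open>Suc K\<close>, the inner range consists of the
  \<open>l\<close> up to \<open>K\<close> with \<open>k = l\<close> or \<open>k = Suc l\<close>. At
  \<open>k = 0\<close> truncated subtraction leaves just \<open>l = 0\<close>, and at
  \<open>k = Suc K\<close> the minimum leaves just \<open>l = K\<close>.\<close>

lemma sum_band_swap:
  fixes F :: "nat \<Rightarrow> nat \<Rightarrow> 'a::comm_monoid_add"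
  shows "(\<Sum>k = 0..Suc K. \<Sum>l = k - 1..min K k. F l k) = (\<Sum>l = 0..K. F l l + F l (Suc l))"
proof -
  have "(\<Sum>k = 0..Suc K. \<Sum>l = k - 1..min K k. F l k)
      = (\<Sum>k = 0..Suc K. \<Sum>l | l \<in> {0..K} \<and> k \<in> {l, Suc l}. F l k)"
    by (intro sum.cong) auto
  also have "\<dots> = (\<Sum>l = 0..K. \<Sum>k | k \<in> {0..Suc K} \<and> k \<in> {l, Suc l}. F l k)"
    by (rule sum.swap_restrict) auto
  also have "\<dots> = (\<Sum>l = 0..K. \<Sum>k\<in>{l, Suc l}. F l k)"
    by (intro sum.cong) auto
  finally show ?thesis by simp
qed

text \<open>An abstract \<open>g\<close> covers both identities: the differentiated interpolant
  gives the first claim and the constant 1 the second. By induction on \<open>K\<close>,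
  \<open>step\<close> splits every substencil of the current level into two, and terms on the same
  substencil are collected.\<close>

lemma sigma_weight_combination:
  fixes g :: "int \<Rightarrow> int \<Rightarrow> real poly fract"
  assumes "inj_on x {a..b}" "int n \<le> b - a - int (Suc K)"
    and step: "\<And>a b. inj_on x {a..b} \<Longrightarrow> int n \<le> b - a - 1 \<Longrightarrow>
      g a b = sigma_weight_1 x n a b 0 * g a (b - 1) + sigma_weight_1 x n a b (Suc 0) * g (a + 1) b"
  shows "g a b = (\<Sum>k = 0..Suc K. sigma_weight x n a b (Suc K) k
                    * g (a + int k) (b - int (Suc K) + int k))"
  using assms(2)
proof (induction K)
  case 0
  then show ?case using step[OF assms(1)] by simp
next
  case (Suc K)
  let ?s = "\<lambda>l. sigma_weight x n a b (Suc K) l"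
  let ?t = "\<lambda>l. sigma_weight_1 x n (a + int l) (b - int (Suc K) + int l)"
  have "g a b = (\<Sum>l = 0..Suc K. ?s l * g (a + int l) (b - int (Suc K) + int l))"
    using Suc by simp
  \<comment> \<open>The differences \<open>l - l\<close> and \<open>Suc l - l\<close> stay
    unevaluated so that both terms are instances of one \<open>F l k\<close>, as
    \<open>sum_band_swap\<close> expects.\<close>
  also have "\<dots> = (\<Sum>l = 0..Suc K.
      ?s l * ?t l (l - l) * g (a + int l) (b - int (Suc (Suc K)) + int l)
      + ?s l * ?t l (Suc l - l) * g (a + int (Suc l)) (b - int (Suc (Suc K)) + int (Suc l)))"
  proof (rule sum.cong[OF refl])
    fix l assume l: "l \<in> {0..Suc K}"
    have "inj_on x {a + int l..b - int (Suc K) + int l}"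
      using assms(1) by (rule inj_on_subset) (use l in auto)
    moreover have "int n \<le> (b - int (Suc K) + int l) - (a + int l) - 1"
      using Suc.prems by simp
    ultimately have "g (a + int l) (b - int (Suc K) + int l) =
        ?t l 0 * g (a + int l) (b - int (Suc K) + int l - 1)
        + ?t l (Suc 0) * g (a + int l + 1) (b - int (Suc K) + int l)"
      by (rule step)
    moreover have "b - int (Suc K) + int l - 1 = b - int (Suc (Suc K)) + int l"
      "a + int l + 1 = a + int (Suc l)"
      "b - int (Suc K) + int l = b - int (Suc (Suc K)) + int (Suc l)" "Suc l - l = Suc 0" "l - l = 0"
      by simp_all
    ultimately show "?s l * g (a + int l) (b - int (Suc K) + int l) =
        ?s l * ?t l (l - l) * g (a + int l) (b - int (Suc (Suc K)) + int l)
      + ?s l * ?t l (Suc l - l) * g (a + int (Suc l)) (b - int (Suc (Suc K)) + int (Suc l))"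
      by (simp only: distrib_left mult.assoc)
  qed
  also have "\<dots> = (\<Sum>k = 0..Suc (Suc K). \<Sum>l = k - 1..min (Suc K) k.
      ?s l * ?t l (k - l) * g (a + int k) (b - int (Suc (Suc K)) + int k))"
    by (rule sum_band_swap[symmetric])
  also have "\<dots> = (\<Sum>k = 0..Suc (Suc K). sigma_weight x n a b (Suc (Suc K)) k
      * g (a + int k) (b - int (Suc (Suc K)) + int k))"
    by (simp only: sigma_weight.simps sum_distrib_right)
  finally show ?case .
qed

text \<open>A weight of the next level is a sum of products of a weight of the current level and a
  level-one weight on a substencil. Where all factors are regular, so is the sum.\<close>

lemma pole_set_Suc_subset:
  "pole_set x n a b (Suc K)
     \<subseteq> (\<Union>L\<in>{0..K}. \<Union>l\<in>{0..L}. pole_set x n (a + int l) (b - int L + int l) 1)"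
proof (induction K)
  case (Suc K)
  let ?U = "\<lambda>K. \<Union>L\<in>{0..K}. \<Union>l\<in>{0..L}. pole_set x n (a + int l) (b - int L + int l) 1"
  show ?case
  proof
    fix t assume t: "t \<in> pole_set x n a b (Suc (Suc K))"
    show "t \<in> ?U (Suc K)"
    proof (rule ccontr)
      assume notin: "t \<notin> ?U (Suc K)"
      have "?U K \<subseteq> ?U (Suc K)" by (intro UN_mono) auto
      with Suc.IH notin have "t \<notin> pole_set x n a b (Suc K)" by blast
      then have old: "\<not> ratfun_pole (sigma_weight x n a b (Suc K) l) t" if "l \<le> Suc K" for l
        using that by (auto simp: pole_set_def)
      have new: "\<not> ratfun_pole (sigma_weight_1 x n (a + int l) (b - int (Suc K) + int l) m) t"
        if "l \<le> Suc K" "m \<le> 1" for l m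
      proof -
        have "t \<notin> pole_set x n (a + int l) (b - int (Suc K) + int l) 1"
        proof -
          have "l \<in> {0..Suc K}" "Suc K \<in> {0..Suc K}" using that(1) by simp_all
          with notin show ?thesis by blast
        qed
        then show ?thesis using that(2) by (auto simp: pole_set_def)
      qed
      have "\<not> ratfun_pole (sigma_weight x n a b (Suc (Suc K)) k) t" for k
        unfolding sigma_weight.simps
        \<comment> \<open>In the summation range \<open>l\<close> is at least \<open>k - 1\<close>,
          so \<open>k - l\<close> is at most 1 and \<open>new\<close> applies.\<close>
        by (intro conjunct1[OF ratfun_sum] ratfun_pole_mult old new) auto
      with t show False by (simp add: pole_set_def)
    qed
  qed
qed simp

text \<open>Both level-one weights have the derivative of the inner nodal polynomial as denominator,
  and \<open>fund_poly x (a + 1) b b\<close> is a constant multiple of that polynomial.\<close>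

lemma pole_set_1_subset:
  assumes "a < b" "inj_on x {a..b}"
  shows "pole_set x n a b 1 \<subseteq> {t. poly ((pderiv ^^ n) (fund_poly x (a + 1) b b)) t = 0}"
proof
  fix t assume "t \<in> pole_set x n a b 1"
  then have "ratfun_pole (sigma_weight_1 x n a b 0) t \<or> ratfun_pole (sigma_weight_1 x n a b (Suc 0)) t"
    by (auto simp: pole_set_def le_Suc_eq)
  then have "poly ((pderiv ^^ n) (nodal_poly x {a<..<b})) t = 0"
    unfolding sigma_weight_1_0[OF assms] sigma_weight_1_1[OF assms]
    using ratfun_pole_imp_denominator_zero by blast
  moreover have "{a + 1..b} - {b} = {a<..<b}" by auto
  ultimately show "t \<in> {t. poly ((pderiv ^^ n) (fund_poly x (a + 1) b b)) t = 0}"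
    by (simp add: fund_poly_eq_lagrange_basis lagrange_basis_def higher_pderiv_smult)
qed

theorem proposition4p2:
  fixes i Mm Mp M :: int and x :: "int \<Rightarrow> real" and K n :: nat
  assumes M_def: "M = Mm + Mp"
    and M_ge: "M \<ge> 2"
    and stencil: "strict_mono_on {i - Mm..i + Mp} x"
    and K_range: "1 \<le> K" "int K \<le> M - 1"
    and n_range: "int n \<le> M - int K"
  shows
    "(\<forall>f :: real \<Rightarrow> real. \<forall>t. t \<notin> pole_set x n (i - Mm) (i + Mp) K \<longrightarrow>
        poly ((pderiv ^^ n) (lagrange_poly x (i - Mm) (i + Mp) f)) t =
        (\<Sum>k = 0..K. ratfun_eval (sigma_weight x n (i - Mm) (i + Mp) K k) t *
           poly ((pderiv ^^ n)
             (lagrange_poly x (i - Mm + int k) (i + Mp - int K + int k) f)) t))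
   \<and> (\<forall>t. t \<notin> pole_set x n (i - Mm) (i + Mp) K \<longrightarrow>
        (\<Sum>k = 0..K. ratfun_eval (sigma_weight x n (i - Mm) (i + Mp) K k) t) = 1)
   \<and> pole_set x n (i - Mm) (i + Mp) 1
        \<subseteq> {t. poly ((pderiv ^^ n) (fund_poly x (i - Mm + 1) (i + Mp) (i + Mp))) t = 0}
   \<and> pole_set x n (i - Mm) (i + Mp) K
        \<subseteq> (\<Union>L\<in>{0..K - 1}. \<Union>l\<in>{0..L}.
              pole_set x n (i - Mm + int l) (i + Mp - int L + int l) 1)
   \<and> (\<Union>L\<in>{0..K - 1}. \<Union>l\<in>{0..L}.
              pole_set x n (i - Mm + int l) (i + Mp - int L + int l) 1)
        \<subseteq> {t. (\<Prod>L = 0..K - 1. \<Prod>l = 0..L.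
              poly ((pderiv ^^ n)
                (fund_poly x (i - Mm + 1 + int l) (i + Mp - int L + int l)
                   (i + Mp - int L + int l))) t) = 0}"
proof (intro conjI allI impI)
  define a b where "a = i - Mm" and "b = i + Mp"
  have inj: "inj_on x {a..b}"
    using strict_mono_on_imp_inj_on[OF stencil] by (simp add: a_def b_def)
  have sub: "inj_on x {a + int l..b - int L + int l}" if "l \<le> L" for l L
    using inj by (rule inj_on_subset) (use that in auto)
  obtain N where N: "K = Suc N" using K_range(1) by (cases K) auto
  have nK: "int n \<le> b - a - int (Suc N)"
    using n_range by (simp add: a_def b_def M_def N)
  {
    fix t assume "t \<notin> pole_set x n (i - Mm) (i + Mp) K"
    then have reg: "\<not> ratfun_pole (sigma_weight x n a b K k) t" if "k \<in> {0..K}" for k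
      using that by (auto simp: pole_set_def a_def b_def)
    \<comment> \<open>Transfers identities between rational functions to values at \<open>t\<close>:
      by \<open>reg\<close> no summand has a pole there.\<close>
    have eval: "ratfun_eval (\<Sum>k = 0..K. sigma_weight x n a b K k * to_fract (p k)) t
        = (\<Sum>k = 0..K. ratfun_eval (sigma_weight x n a b K k) t * poly (p k) t)" for p
    proof -
      have "ratfun_eval (\<Sum>k = 0..K. sigma_weight x n a b K k * to_fract (p k)) t
          = (\<Sum>k = 0..K. ratfun_eval (sigma_weight x n a b K k * to_fract (p k)) t)"
        by (intro conjunct2[OF ratfun_sum] ratfun_pole_mult reg ratfun_to_fract)
      also have "\<dots> = (\<Sum>k = 0..K. ratfun_eval (sigma_weight x n a b K k) t * poly (p k) t)"
        by (intro sum.cong) (simp_all add: ratfun_eval_mult reg)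
      finally show ?thesis .
    qed
    show "poly ((pderiv ^^ n) (lagrange_poly x (i - Mm) (i + Mp) f)) t =
        (\<Sum>k = 0..K. ratfun_eval (sigma_weight x n (i - Mm) (i + Mp) K k) t *
           poly ((pderiv ^^ n)
             (lagrange_poly x (i - Mm + int k) (i + Mp - int K + int k) f)) t)" for f
      using arg_cong[OF sigma_weight_combination[OF inj nK sigma_weight_1_lagrange[of x _ _ n f]],
          of "\<lambda>r. ratfun_eval r t"]
      unfolding N[symmetric] eval by (simp add: a_def b_def)
    \<comment> \<open>The instance with \<open>g\<close> constantly 1; the factor
      \<open>to_fract 1\<close> gives the sum the shape that \<open>eval\<close> rewrites.\<close>
    have "(1 :: real poly fract) = (\<Sum>k = 0..K. sigma_weight x n a b K k * to_fract 1)"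
      using sigma_weight_combination[OF inj nK, of "\<lambda>_ _. 1"] sigma_weight_1_sum
      by (simp add: N)
    from arg_cong[OF this, of "\<lambda>r. ratfun_eval r t"]
    show "(\<Sum>k = 0..K. ratfun_eval (sigma_weight x n (i - Mm) (i + Mp) K k) t) = 1"
      unfolding eval using ratfun_to_fract(2)[of 1 t] by (simp add: a_def b_def)
  }
  show "pole_set x n (i - Mm) (i + Mp) 1
        \<subseteq> {t. poly ((pderiv ^^ n) (fund_poly x (i - Mm + 1) (i + Mp) (i + Mp))) t = 0}"
    using pole_set_1_subset[of a b x n] inj M_ge by (simp add: a_def b_def M_def)
  show "pole_set x n (i - Mm) (i + Mp) K
        \<subseteq> (\<Union>L\<in>{0..K - 1}. \<Union>l\<in>{0..L}.
              pole_set x n (i - Mm + int l) (i + Mp - int L + int l) 1)"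
    using pole_set_Suc_subset[of x n "i - Mm" "i + Mp" N] by (simp add: N)
  show "(\<Union>L\<in>{0..K - 1}. \<Union>l\<in>{0..L}.
              pole_set x n (i - Mm + int l) (i + Mp - int L + int l) 1)
        \<subseteq> {t. (\<Prod>L = 0..K - 1. \<Prod>l = 0..L.
              poly ((pderiv ^^ n)
                (fund_poly x (i - Mm + 1 + int l) (i + Mp - int L + int l)
                   (i + Mp - int L + int l))) t) = 0}"
  proof (intro UN_least)
    fix L l assume L: "L \<in> {0..K - 1}" and l: "l \<in> {0..L}"
    \<comment> \<open>Since \<open>L\<close> is at most \<open>K - 1\<close> and \<open>K\<close> at
      most \<open>M - 1\<close>, the substencil keeps at least three points.\<close>
    have "a + int l < b - int L + int l"
      using L K_range by (simp add: a_def b_def M_def)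
    from pole_set_1_subset[OF this sub, of n] l
    have "pole_set x n (i - Mm + int l) (i + Mp - int L + int l) 1
        \<subseteq> {t. poly ((pderiv ^^ n) (fund_poly x (i - Mm + 1 + int l) (i + Mp - int L + int l)
                   (i + Mp - int L + int l))) t = 0}"
      by (simp add: a_def b_def algebra_simps)
    also have "\<dots> \<subseteq> {t. (\<Prod>L = 0..K - 1. \<Prod>l = 0..L.
              poly ((pderiv ^^ n)
                (fund_poly x (i - Mm + 1 + int l) (i + Mp - int L + int l)
                   (i + Mp - int L + int l))) t) = 0}"
    proof
      fix t
      assume "t \<in> {t. poly ((pderiv ^^ n) (fund_poly x (i - Mm + 1 + int l) (i + Mp - int L + int l)
                   (i + Mp - int L + int l))) t = 0}"
      \<comment> \<open>One vanishing factor annihilates first the inner and then the outer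
        product.\<close>
      then have "(\<Prod>l = 0..L. poly ((pderiv ^^ n) (fund_poly x (i - Mm + 1 + int l)
          (i + Mp - int L + int l) (i + Mp - int L + int l))) t) = 0"
        using l by (intro prod_zero) auto
      then show "t \<in> {t. (\<Prod>L = 0..K - 1. \<Prod>l = 0..L.
              poly ((pderiv ^^ n)
                (fund_poly x (i - Mm + 1 + int l) (i + Mp - int L + int l)
                   (i + Mp - int L + int l))) t) = 0}"
        using L unfolding mem_Collect_eq by (intro prod_zero) blast+
    qed
    finally show "pole_set x n (i - Mm + int l) (i + Mp - int L + int l) 1 \<subseteq> \<dots>" .
  qed
qed

end
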